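(* Let $T$ be a tree with $k$ edges such that, in the proper vertex $2$-coloring of $T$, all leaves of $T$ receive the same color. Then there exists $n_0$ (depending on $T$) such that for all $n\ge n_0$, \[ \mathrm{ex}^c(n,T)=\left\lfloor \frac{n^2}{4}\right\rfloor . \]
   Context: For a tree $T$, $\mathrm{ex}^c(n,T)$ denotes the maximum number of edges of an $n$-vertex graph $G$ that admits a proper vertex coloring (with any number of colors) such that in every copy of $T$ in $G$ (every subgraph of $G$ isomorphic to $T$), all leaves of that copy have the same color. *)

theory Defs
  imports Main
begin

record 'a ugraph =
  uverts :: "'a set"
  uedges :: "'a set set"

definition simple_graph :: "'a ugraph \<Rightarrow> bool" where
  "simple_graph G \<longleftrightarrow>
     finite (uverts G) \<and> (\<forall>e\<in>uedges G. e \<subseteq> uverts G \<and> card e = 2)"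

definition graph_connected :: "'a ugraph \<Rightarrow> bool" where
  "graph_connected G \<longleftrightarrow>
     uverts G \<noteq> {} \<and>
     (\<forall>u\<in>uverts G. \<forall>v\<in>uverts G. (u, v) \<in> {(x, y). {x, y} \<in> uedges G}\<^sup>*)"

definition graph_cycle :: "'a ugraph \<Rightarrow> 'a list \<Rightarrow> bool" where
  "graph_cycle G xs \<longleftrightarrow>
     3 \<le> length xs \<and> distinct xs \<and>
     (\<forall>i<length xs. {xs ! i, xs ! (Suc i mod length xs)} \<in> uedges G)"

definition tree_graph :: "'a ugraph \<Rightarrow> bool" where
  "tree_graph T \<longleftrightarrow>
     simple_graph T \<and> graph_connected T \<and> (\<nexists>xs. graph_cycle T xs)"

definition vertex_degree :: "'a ugraph \<Rightarrow> 'a \<Rightarrow> nat" where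
  "vertex_degree G v = card {e \<in> uedges G. v \<in> e}"

definition graph_leaves :: "'a ugraph \<Rightarrow> 'a set" where
  "graph_leaves G = {v \<in> uverts G. vertex_degree G v = 1}"

definition sub_graph :: "'a ugraph \<Rightarrow> 'a ugraph \<Rightarrow> bool" where
  "sub_graph H G \<longleftrightarrow>
     simple_graph H \<and> uverts H \<subseteq> uverts G \<and> uedges H \<subseteq> uedges G"

definition graph_isomorphic :: "'a ugraph \<Rightarrow> 'b ugraph \<Rightarrow> bool" where
  "graph_isomorphic G H \<longleftrightarrow>
     (\<exists>f. bij_betw f (uverts G) (uverts H) \<and> uedges H = (\<lambda>e. f ` e) ` uedges G)"

definition proper_vertex_coloring :: "'a ugraph \<Rightarrow> ('a \<Rightarrow> 'c) \<Rightarrow> bool" where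
  "proper_vertex_coloring G c \<longleftrightarrow> (\<forall>u v. {u, v} \<in> uedges G \<longrightarrow> c u \<noteq> c v)"

definition leaves_same_color :: "'a ugraph \<Rightarrow> ('a \<Rightarrow> 'c) \<Rightarrow> bool" where
  "leaves_same_color G c \<longleftrightarrow> (\<forall>u\<in>graph_leaves G. \<forall>v\<in>graph_leaves G. c u = c v)"

text \<open>Since \<open>G\<close> is finite, colors in \<open>nat\<close> amount to an unrestricted number of colors.\<close>

definition leaf_colorable :: "'t ugraph \<Rightarrow> 'a ugraph \<Rightarrow> bool" where
  "leaf_colorable T G \<longleftrightarrow>
     (\<exists>c :: 'a \<Rightarrow> nat. proper_vertex_coloring G c \<and>
        (\<forall>H. sub_graph H G \<and> graph_isomorphic T H \<longrightarrow> leaves_same_color H c))"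

text \<open>Every finite graph is isomorphic to one with vertices in \<open>nat\<close>, so nothing is lost by
  ranging over \<open>nat ugraph\<close>. The lemmas below justify the use of \<open>Max\<close>.\<close>

definition ex_c_sizes :: "nat \<Rightarrow> 't ugraph \<Rightarrow> nat set" where
  "ex_c_sizes n T =
     {card (uedges G) | G :: nat ugraph.
        simple_graph G \<and> card (uverts G) = n \<and> leaf_colorable T G}"

definition ex_c :: "nat \<Rightarrow> 't ugraph \<Rightarrow> nat" where
  "ex_c n T = Max (ex_c_sizes n T)"

lemma finite_ex_c_sizes: "finite (ex_c_sizes n T)"
proof (rule finite_subset)
  show "ex_c_sizes n T \<subseteq> {..2 ^ n}"
  proof
    fix m assume "m \<in> ex_c_sizes n T"
    then obtain G :: "nat ugraph" where
      G: "m = card (uedges G)" "simple_graph G" "card (uverts G) = n"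
      unfolding ex_c_sizes_def by blast
    have "uedges G \<subseteq> Pow (uverts G)" "finite (uverts G)"
      using G(2) by (auto simp: simple_graph_def)
    then have "card (uedges G) \<le> card (Pow (uverts G))"
      by (intro card_mono) auto
    then show "m \<in> {..2 ^ n}"
      using G \<open>finite (uverts G)\<close> by (simp add: card_Pow)
  qed
qed simp

lemma ex_c_sizes_nonempty: "ex_c_sizes n T \<noteq> {}"
proof -
  let ?G = "\<lparr>uverts = {..<n}, uedges = {}\<rparr> :: nat ugraph"
  have "simple_graph ?G" "card (uverts ?G) = n"
    by (simp_all add: simple_graph_def)
  moreover have "leaf_colorable T ?G"
    unfolding leaf_colorable_def
    by (rule exI[of _ "\<lambda>_. 0"])
       (auto simp: proper_vertex_coloring_def leaves_same_color_def)
  ultimately show ?thesis unfolding ex_c_sizes_def by blast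
qed

end

theory Submission
  imports Defs
begin

text \<open>If every vertex of \<open>G\<close> has degree larger than the number of vertices of \<open>T\<close>, fix a leaf of
  \<open>T\<close> with its neighbour. For any vertex \<open>u\<close> of \<open>G\<close> with neighbours \<open>w\<close>, \<open>w'\<close>, the tree without the
  leaf embeds greedily so that the neighbour goes to \<open>u\<close> and \<open>w\<close>, \<open>w'\<close> are avoided; placing the leaf
  at \<open>w\<close> or at \<open>w'\<close> yields two copies that share another leaf. Hence neighbourhoods are
  monochromatic, \<open>G\<close> is triangle-free and has at most \<open>n\<^sup>2/4\<close> edges. In general, each deletion of a
  vertex of bounded degree increases the surplus over \<open>n\<^sup>2/4\<close>, so a positive surplus would
  eventually exceed the number of all pairs of vertices.\<close>

section \<open>Finite simple graphs: neighbourhoods, degrees and vertex deletion\<close>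

definition delete_vertex :: "'a ugraph \<Rightarrow> 'a \<Rightarrow> 'a ugraph" where
  "delete_vertex G v = \<lparr>uverts = uverts G - {v}, uedges = {e \<in> uedges G. v \<notin> e}\<rparr>"

definition neighbors :: "'a ugraph \<Rightarrow> 'a \<Rightarrow> 'a set" where
  "neighbors G v = {w. {v, w} \<in> uedges G}"

definition graph_path :: "'a ugraph \<Rightarrow> 'a list \<Rightarrow> bool" where
  "graph_path G xs \<longleftrightarrow>
     distinct xs \<and> set xs \<subseteq> uverts G \<and> successively (\<lambda>x y. {x, y} \<in> uedges G) xs"

text \<open>Non-edges of \<open>H\<close> may go to edges of \<open>G\<close>: copies are subgraphs,
  not necessarily induced ones.\<close>

definition graph_embedding :: "'a ugraph \<Rightarrow> 'b ugraph \<Rightarrow> ('a \<Rightarrow> 'b) \<Rightarrow> bool" where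
  "graph_embedding H G f \<longleftrightarrow>
     inj_on f (uverts H) \<and> f ` uverts H \<subseteq> uverts G \<and> (\<forall>e\<in>uedges H. f ` e \<in> uedges G)"

lemma finite_uedges: "simple_graph G \<Longrightarrow> finite (uedges G)"
  by (rule finite_subset[of _ "Pow (uverts G)"]) (auto simp: simple_graph_def)

lemma simple_graph_edgeD:
  assumes "simple_graph G" "{u, v} \<in> uedges G"
  shows "u \<in> uverts G" "v \<in> uverts G" "u \<noteq> v"
proof -
  have "{u, v} \<subseteq> uverts G" "card {u, v} = 2"
    using assms by (auto simp: simple_graph_def)
  then show "u \<in> uverts G" "v \<in> uverts G" "u \<noteq> v" by auto
qed

lemma simple_graph_edgeE:
  assumes "simple_graph G" "e \<in> uedges G" "v \<in> e"
  obtains w where "e = {v, w}" "w \<noteq> v"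
proof -
  have "card e = 2" using assms by (auto simp: simple_graph_def)
  then obtain x y where "e = {x, y}" "x \<noteq> y" by (auto simp: card_2_iff)
  then show thesis using assms(3) that by (metis insert_commute insert_iff singletonD)
qed

lemma neighbors_subset: "simple_graph G \<Longrightarrow> neighbors G v \<subseteq> uverts G"
  using simple_graph_edgeD by (fastforce simp: neighbors_def)

lemma finite_neighbors: "simple_graph G \<Longrightarrow> finite (neighbors G v)"
  by (rule finite_subset[OF neighbors_subset]) (simp_all add: simple_graph_def)

lemma vertex_degree_eq_card_neighbors:
  assumes "simple_graph G"
  shows "vertex_degree G v = card (neighbors G v)"
proof -
  have "inj_on (\<lambda>w. {v, w}) (neighbors G v)"
    by (auto simp: inj_on_def doubleton_eq_iff)
  moreover have "(\<lambda>w. {v, w}) ` neighbors G v = {e \<in> uedges G. v \<in> e}"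
  proof
    show "{e \<in> uedges G. v \<in> e} \<subseteq> (\<lambda>w. {v, w}) ` neighbors G v"
    proof
      fix e assume e: "e \<in> {e \<in> uedges G. v \<in> e}"
      then obtain w where "e = {v, w}" using simple_graph_edgeE[OF assms, of e v] by auto
      with e show "e \<in> (\<lambda>w. {v, w}) ` neighbors G v" by (simp add: neighbors_def)
    qed
  qed (auto simp: neighbors_def)
  ultimately show ?thesis
    unfolding vertex_degree_def by (metis card_image)
qed

lemma simple_graph_delete_vertex: "simple_graph G \<Longrightarrow> simple_graph (delete_vertex G v)"
  by (auto simp: simple_graph_def delete_vertex_def)

lemma card_uverts_delete_vertex:
  "simple_graph G \<Longrightarrow> v \<in> uverts G \<Longrightarrow> card (uverts (delete_vertex G v)) = card (uverts G) - 1"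
  by (simp add: delete_vertex_def)

lemma card_uedges_delete_vertex:
  assumes "simple_graph G"
  shows "card (uedges G) = card (uedges (delete_vertex G v)) + vertex_degree G v"
proof -
  have "card (uedges G) = card ({e \<in> uedges G. v \<notin> e} \<union> {e \<in> uedges G. v \<in> e})"
    by (rule arg_cong[where f = card]) auto
  also have "\<dots> = card {e \<in> uedges G. v \<notin> e} + card {e \<in> uedges G. v \<in> e}"
    by (rule card_Un_disjoint) (use finite_uedges[OF assms] in auto)
  finally show ?thesis by (simp add: delete_vertex_def vertex_degree_def)
qed

text \<open>Passing to a subgraph only removes edges and copies of \<open>T\<close>, so the same
  coloring works. This lets the property survive vertex deletions.\<close>

lemma leaf_colorable_sub_graph:
  assumes "leaf_colorable T G" "sub_graph H G"
  shows "leaf_colorable T H"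
proof -
  have "sub_graph K G" if "sub_graph K H" for K
    using that assms(2) by (auto simp: sub_graph_def)
  then show ?thesis
    using assms unfolding leaf_colorable_def proper_vertex_coloring_def
    by (meson sub_graph_def subsetD)
qed

lemma sub_graph_delete_vertex: "simple_graph G \<Longrightarrow> sub_graph (delete_vertex G v) G"
  using simple_graph_delete_vertex[of G v] by (auto simp: sub_graph_def delete_vertex_def)

subsection \<open>Leaves of trees\<close>

text \<open>A neighbour of the first vertex must lie on the path, else it could be put in front. If
  it came later than the second place, it would close a cycle. Only the second vertex
  remains.\<close>

lemma leaf_of_longest_path:
  assumes T: "tree_graph T"
    and path: "graph_path T xs" and len: "2 \<le> length xs"
    and longest: "\<And>ys. graph_path T ys \<Longrightarrow> length ys \<le> length xs"
  shows "hd xs \<in> graph_leaves T"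
proof -
  have G: "simple_graph T" and acyclic: "\<And>xs. \<not> graph_cycle T xs"
    using T by (auto simp: tree_graph_def)
  obtain v w zs where xs: "xs = v # w # zs"
    using len by (cases xs; cases "tl xs") auto
  have vw: "{v, w} \<in> uedges T" using path by (simp add: xs graph_path_def)
  have "y = w" if y: "{v, y} \<in> uedges T" for y
  proof -
    have "y \<in> set xs"
    proof (rule ccontr)
      assume "y \<notin> set xs"
      then have "graph_path T (y # xs)"
        using path y simple_graph_edgeD[OF G y]
        by (simp add: graph_path_def xs insert_commute)
      then show False using longest by fastforce
    qed
    then obtain j where j: "j < length xs" "xs ! j = y" by (auto simp: in_set_conv_nth)
    have "\<not> 2 \<le> j"
    proof
      \<comment> \<open>The prefix of \<open>xs\<close> ending in \<open>y\<close> has at least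
        three vertices and is closed by the edge from \<open>y\<close> back to \<open>v\<close>;
        index \<open>j\<close> is where the cyclic successor wraps to 0.\<close>
      assume "2 \<le> j"
      have "{take (Suc j) xs ! i, take (Suc j) xs ! (Suc i mod Suc j)} \<in> uedges T"
        if "i < Suc j" for i
      proof (cases "i = j")
        case True
        then have "take (Suc j) xs ! i = y" using j by simp
        moreover have "take (Suc j) xs ! (Suc i mod Suc j) = v" using True by (simp add: xs)
        ultimately show ?thesis using y by (simp add: insert_commute)
      next
        case False
        then have "Suc i < length xs" "Suc i < Suc j" using that j by auto
        then show ?thesis
          using path that by (simp add: graph_path_def successively_conv_nth)
      qed
      then have "graph_cycle T (take (Suc j) xs)"
        using \<open>2 \<le> j\<close> j path by (simp add: graph_cycle_def graph_path_def)
      then show False using acyclic by blast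
    qed
    moreover have "j \<noteq> 0"
    proof
      assume "j = 0"
      then have "y = v" using j(2) by (simp add: xs)
      then show False using simple_graph_edgeD(3)[OF G y] by simp
    qed
    ultimately have "j = 1" by simp
    then show ?thesis using j by (simp add: xs)
  qed
  then have "neighbors T v = {w}" using vw unfolding neighbors_def by blast
  then show ?thesis
    using simple_graph_edgeD[OF G vw]
    by (simp add: graph_leaves_def vertex_degree_eq_card_neighbors[OF G] xs)
qed

text \<open>Both ends of a longest path are leaves: the reversed path is again longest. The two ends
  differ because an edge is already a path with two vertices.\<close>

lemma tree_has_two_leaves:
  assumes T: "tree_graph T" and e: "uedges T \<noteq> {}"
  obtains u v where "u \<in> graph_leaves T" "v \<in> graph_leaves T" "u \<noteq> v"
proof -
  have G: "simple_graph T" using T by (simp add: tree_graph_def)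
  obtain x y where xy: "{x, y} \<in> uedges T"
    using e G by (metis card_2_iff ex_in_conv simple_graph_def)
  have "graph_path T [x, y]"
    using simple_graph_edgeD[OF G xy] xy by (simp add: graph_path_def)
  moreover have bound: "length ys \<le> card (uverts T)" if "graph_path T ys" for ys
    using that G by (metis card_mono distinct_card graph_path_def simple_graph_def)
  ultimately obtain xs where path: "graph_path T xs"
    and longest: "\<And>ys. graph_path T ys \<Longrightarrow> length ys \<le> length xs"
    using ex_has_greatest_nat[of "graph_path T" "[x, y]" length "Suc (card (uverts T))"]
    by (metis le_imp_less_Suc)
  have len: "2 \<le> length xs" using longest[OF \<open>graph_path T [x, y]\<close>] by simp
  have "graph_path T (rev xs)"
    using path by (simp add: graph_path_def insert_commute)
  then have "hd (rev xs) \<in> graph_leaves T"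
    by (rule leaf_of_longest_path[OF T]) (use len longest in auto)
  moreover have "hd xs \<in> graph_leaves T"
    by (rule leaf_of_longest_path[OF T path len longest])
  moreover have "hd xs \<noteq> hd (rev xs)"
  proof -
    obtain v w zs where "xs = v # w # zs"
      using len by (cases xs; cases "tl xs") auto
    then show ?thesis using path by (cases zs rule: rev_cases) (auto simp: graph_path_def)
  qed
  ultimately show thesis using that by blast
qed

lemma leaf_neighborE:
  assumes "simple_graph T" "l \<in> graph_leaves T"
  obtains p where "neighbors T l = {p}" "{l, p} \<in> uedges T" "p \<in> uverts T" "p \<noteq> l"
proof -
  have "card (neighbors T l) = 1"
    using assms by (simp add: graph_leaves_def vertex_degree_eq_card_neighbors)
  then obtain p where p: "neighbors T l = {p}" by (auto simp: card_1_singleton_iff)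
  then have "{l, p} \<in> uedges T" by (auto simp: neighbors_def)
  with p that show thesis using simple_graph_edgeD[OF assms(1)] by metis
qed

lemma tree_graph_delete_leaf:
  assumes T: "tree_graph T" and l: "l \<in> graph_leaves T"
  shows "tree_graph (delete_vertex T l)"
proof -
  have G: "simple_graph T" and conn: "graph_connected T" and acyclic: "\<And>xs. \<not> graph_cycle T xs"
    using T by (auto simp: tree_graph_def)
  obtain p where p: "neighbors T l = {p}" "p \<in> uverts T" "p \<noteq> l"
    using leaf_neighborE[OF G l] by metis
  let ?T = "delete_vertex T l"
  let ?R = "{(x, y). {x, y} \<in> uedges ?T}"
  \<comment> \<open>Walks are rerouted by reading every visit to \<open>l\<close> as a visit to
    \<open>p\<close>. A step into or out of \<open>l\<close> then becomes stationary, since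
    \<open>p\<close> is the only neighbour of \<open>l\<close>.\<close>
  have reach: "(u, if z = l then p else z) \<in> ?R\<^sup>*"
    if "(u, z) \<in> {(x, y). {x, y} \<in> uedges T}\<^sup>*" "u \<noteq> l" for u z
    using that(1)
  proof (induction rule: rtrancl_induct)
    case base
    then show ?case using that(2) by simp
  next
    case (step y z)
    then have yz: "{y, z} \<in> uedges T" by simp
    consider "y = l" | "y \<noteq> l" "z = l" | "y \<noteq> l" "z \<noteq> l" by blast
    then show ?case
    proof cases
      case 1
      then have "z \<in> neighbors T l" using yz by (simp add: neighbors_def)
      then have "z = p" using p by simp
      then show ?thesis using step.IH 1 p by simp
    next
      case 2
      then have "y \<in> neighbors T l" using yz by (simp add: neighbors_def insert_commute)
      then have "y = p" using p by simp
      then show ?thesis using step.IH 2 by simp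
    next
      case 3
      then have "(y, z) \<in> ?R" using yz by (simp add: delete_vertex_def)
      then show ?thesis using step.IH 3 by (simp add: rtrancl_into_rtrancl)
    qed
  qed
  have "graph_connected ?T"
    unfolding graph_connected_def
  proof (intro conjI ballI)
    show "uverts ?T \<noteq> {}" using p by (auto simp: delete_vertex_def)
  next
    fix u v assume "u \<in> uverts ?T" "v \<in> uverts ?T"
    then have "u \<in> uverts T" "v \<in> uverts T" "u \<noteq> l" "v \<noteq> l" by (auto simp: delete_vertex_def)
    then show "(u, v) \<in> ?R\<^sup>*"
      using reach[of u v] conn by (simp add: graph_connected_def)
  qed
  moreover have "\<not> graph_cycle ?T xs" for xs
    using acyclic[of xs] by (auto simp: graph_cycle_def delete_vertex_def)
  ultimately show ?thesis
    using simple_graph_delete_vertex[OF G] by (simp add: tree_graph_def)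
qed

subsection \<open>Embedding trees\<close>

text \<open>The only edge of \<open>T\<close> at \<open>l\<close> leads to \<open>p\<close>, so a
  new image for \<open>l\<close> has to be adjacent to \<open>f p\<close> and fresh, nothing
  more.\<close>

lemma graph_embedding_extend_leaf:
  assumes T: "simple_graph T" and p: "neighbors T l = {p}" "p \<noteq> l"
    and f: "graph_embedding (delete_vertex T l) G f"
    and G: "simple_graph G"
    and w: "w \<in> neighbors G (f p)" "w \<notin> f ` (uverts T - {l})"
  shows "graph_embedding T G (f(l := w))"
  unfolding graph_embedding_def
proof (intro conjI ballI)
  show "inj_on (f(l := w)) (uverts T)"
    using f w by (fastforce simp: graph_embedding_def delete_vertex_def inj_on_def)
  show "(f(l := w)) ` uverts T \<subseteq> uverts G"
    using f w neighbors_subset[OF G] by (auto simp: graph_embedding_def delete_vertex_def)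
next
  fix e assume e: "e \<in> uedges T"
  show "(f(l := w)) ` e \<in> uedges G"
  proof (cases "l \<in> e")
    case True
    obtain z where z: "e = {l, z}" using simple_graph_edgeE[OF T e True] by metis
    then have "z = p" using p e by (auto simp: neighbors_def)
    then show ?thesis using z w p by (simp add: neighbors_def insert_commute)
  next
    case False
    then have "(f(l := w)) ` e = f ` e" by (auto simp: image_def)
    then show ?thesis using f e False by (simp add: graph_embedding_def delete_vertex_def)
  qed
qed

text \<open>Greedy embedding by induction on the size of \<open>T\<close>: remove a leaf, embed the
  rest, then put the leaf back. With \<open>X\<close> fixed, the degree hypothesis only gets weaker
  for smaller trees.\<close>

lemma tree_embedding_avoiding:
  fixes T :: "'t ugraph" and G :: "'a ugraph"
  assumes "tree_graph T" "r \<in> uverts T"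
    and G: "simple_graph G" and X: "finite X" and u: "u \<in> uverts G" "u \<notin> X"
    and "\<And>v. v \<in> uverts G \<Longrightarrow> card (uverts T) + card X \<le> vertex_degree G v"
  shows "\<exists>f. graph_embedding T G f \<and> f r = u \<and> f ` uverts T \<inter> X = {}"
  using assms(1,2,7)
proof (induction "card (uverts T)" arbitrary: T)
  case 0
  have "finite (uverts T)"
    using 0(2) by (simp add: tree_graph_def simple_graph_def)
  then have "uverts T = {}" using 0(1) card_0_eq by metis
  then show ?case using 0(3) by blast
next
  case (Suc m)
  have T: "simple_graph T" using Suc.prems(1) by (simp add: tree_graph_def)
  show ?case
  proof (cases "uedges T = {}")
    case True
    have "v = r" if "v \<in> uverts T" for v
    proof -
      have "(r, v) \<in> {(x, y). {x, y} \<in> uedges T}\<^sup>*"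
        using that Suc.prems(1,2) by (simp add: tree_graph_def graph_connected_def)
      then show ?thesis using True by simp
    qed
    then have "uverts T = {r}" using Suc.prems(2) by blast
    then show ?thesis using u True by (intro exI[of _ "\<lambda>_. u"]) (simp add: graph_embedding_def)
  next
    case False
    \<comment> \<open>Having two leaves, \<open>T\<close> has one other than the root, so the
      prescribed image of \<open>r\<close> is kept.\<close>
    obtain l where l: "l \<in> graph_leaves T" "l \<noteq> r"
      using tree_has_two_leaves[OF Suc.prems(1) False] by metis
    obtain p where p: "neighbors T l = {p}" "p \<in> uverts T" "p \<noteq> l"
      using leaf_neighborE[OF T l(1)] by metis
    let ?T = "delete_vertex T l"
    have lT: "l \<in> uverts T" using l by (simp add: graph_leaves_def)
    have card: "card (uverts ?T) = m"
      using card_uverts_delete_vertex[OF T lT] Suc.hyps(2) by simp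
    have "\<exists>f. graph_embedding ?T G f \<and> f r = u \<and> f ` uverts ?T \<inter> X = {}"
    proof (rule Suc.hyps(1))
      show "m = card (uverts ?T)" using card by simp
      show "tree_graph ?T" by (rule tree_graph_delete_leaf[OF Suc.prems(1) l(1)])
      show "r \<in> uverts ?T" using l Suc.prems(2) by (simp add: delete_vertex_def)
      show "card (uverts ?T) + card X \<le> vertex_degree G v" if "v \<in> uverts G" for v
        using Suc.prems(3)[OF that] card Suc.hyps(2) by simp
    qed
    then obtain f where f: "graph_embedding ?T G f" "f r = u" "f ` uverts ?T \<inter> X = {}"
      by blast
    have fin: "finite (uverts ?T)"
      using T by (simp add: simple_graph_def delete_vertex_def)
    have "f p \<in> uverts G"
      using f p by (auto simp: graph_embedding_def delete_vertex_def)
    from Suc.prems(3)[OF this] have "Suc m + card X \<le> card (neighbors G (f p))"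
      using Suc.hyps(2) by (simp add: vertex_degree_eq_card_neighbors[OF G])
    moreover
    \<comment> \<open>At most \<open>m + card X\<close> vertices are forbidden, fewer than the
      neighbours of \<open>f p\<close>.\<close>
    have "card (f ` uverts ?T \<union> X) \<le> m + card X"
      using card_Un_le[of "f ` uverts ?T" X] card_image_le[OF fin, of f] card by linarith
    ultimately have "card (f ` uverts ?T \<union> X) < card (neighbors G (f p))" by linarith
    moreover have "finite (f ` uverts ?T \<union> X)" using fin X by simp
    ultimately have "\<not> neighbors G (f p) \<subseteq> f ` uverts ?T \<union> X"
      using card_mono[of "f ` uverts ?T \<union> X" "neighbors G (f p)"] by linarith
    then obtain w where w: "w \<in> neighbors G (f p)" "w \<notin> f ` uverts ?T" "w \<notin> X" by blast
    have "graph_embedding T G (f(l := w))"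
      by (rule graph_embedding_extend_leaf[OF T p(1,3) f(1) G w(1)])
        (use w in \<open>simp add: delete_vertex_def\<close>)
    moreover have "(f(l := w)) r = u" using f l by simp
    moreover have "(f(l := w)) ` uverts T \<inter> X = {}"
      using f(3) w by (auto simp: delete_vertex_def)
    ultimately show ?thesis by blast
  qed
qed

subsection \<open>Leaves of copies\<close>

text \<open>Edges lie inside the vertex set, where \<open>f\<close> is injective; hence taking
  images is injective on edges, preserves incidence and so preserves degrees.\<close>

lemma graph_leaves_image:
  assumes H: "simple_graph H" and inj: "inj_on f (uverts H)"
    and K: "uverts K = f ` uverts H" "uedges K = (\<lambda>e. f ` e) ` uedges H"
  shows "graph_leaves K = f ` graph_leaves H"
proof -
  have "vertex_degree K (f v) = vertex_degree H v" if v: "v \<in> uverts H" for v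
  proof -
    have sub: "e \<subseteq> uverts H" if "e \<in> uedges H" for e
      using H that by (auto simp: simple_graph_def)
    have "f v \<in> f ` e \<longleftrightarrow> v \<in> e" if "e \<in> uedges H" for e
      using inj_on_image_mem_iff[OF inj v sub[OF that]] .
    then have "{e \<in> uedges K. f v \<in> e} = (\<lambda>e. f ` e) ` {e \<in> uedges H. v \<in> e}"
      by (auto simp: K)
    moreover have "inj_on (\<lambda>e. f ` e) {e \<in> uedges H. v \<in> e}"
      by (rule inj_on_subset[OF inj_on_image_Pow[OF inj]]) (use sub in blast)
    ultimately show ?thesis unfolding vertex_degree_def by (simp add: card_image)
  qed
  then show ?thesis by (auto simp: graph_leaves_def K)
qed

lemma graph_embedding_leaves_same_color:
  assumes T: "simple_graph T" and f: "graph_embedding T G f"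
    and c: "\<And>H. sub_graph H G \<Longrightarrow> graph_isomorphic T H \<Longrightarrow> leaves_same_color H c"
    and "u \<in> graph_leaves T" "v \<in> graph_leaves T"
  shows "c (f u) = c (f v)"
proof -
  let ?H = "\<lparr>uverts = f ` uverts T, uedges = (\<lambda>e. f ` e) ` uedges T\<rparr>"
  have inj: "inj_on f (uverts T)" using f by (simp add: graph_embedding_def)
  have "e \<subseteq> uverts T" "card (f ` e) = 2" if "e \<in> uedges T" for e
  proof -
    show "e \<subseteq> uverts T" using that T by (simp add: simple_graph_def)
    then show "card (f ` e) = 2"
      using that T card_image[OF inj_on_subset[OF inj]] by (simp add: simple_graph_def)
  qed
  then have "simple_graph ?H"
    using T by (simp add: simple_graph_def image_mono)
  then have "sub_graph ?H G"
    using f by (auto simp: sub_graph_def graph_embedding_def)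
  moreover have "graph_isomorphic T ?H"
    using inj by (auto simp: graph_isomorphic_def bij_betw_def)
  ultimately have "leaves_same_color ?H c" by (rule c)
  moreover have "graph_leaves ?H = f ` graph_leaves T"
    by (rule graph_leaves_image[OF T inj]) simp_all
  ultimately show ?thesis using assms(4,5) unfolding leaves_same_color_def by blast
qed

subsection \<open>The upper bound\<close>

lemma monochromatic_neighbors:
  assumes T: "tree_graph T" "uedges T \<noteq> {}" and G: "simple_graph G"
    and deg: "\<And>v. v \<in> uverts G \<Longrightarrow> card (uverts T) < vertex_degree G v"
    and c: "\<And>H. sub_graph H G \<Longrightarrow> graph_isomorphic T H \<Longrightarrow> leaves_same_color H c"
    and w: "w \<in> neighbors G u" "w' \<in> neighbors G u"
  shows "c w = c w'"
proof -
  have sT: "simple_graph T" using T by (simp add: tree_graph_def)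
  obtain l l' where l: "l \<in> graph_leaves T" "l' \<in> graph_leaves T" "l \<noteq> l'"
    using tree_has_two_leaves[OF T] by metis
  obtain p where p: "neighbors T l = {p}" "p \<in> uverts T" "p \<noteq> l"
    using leaf_neighborE[OF sT l(1)] by metis
  let ?T = "delete_vertex T l"
  have u: "u \<in> uverts G" "u \<notin> {w, w'}"
    using w simple_graph_edgeD[OF G] by (auto simp: neighbors_def)
  have lT: "l \<in> uverts T" using l by (simp add: graph_leaves_def)
  then have pos: "0 < card (uverts T)" using sT by (auto simp: simple_graph_def card_gt_0_iff)
  \<comment> \<open>One vertex fewer in the tree and at most two vertices to avoid require degree
    \<open>card (uverts T) + 1\<close>, which is what \<open>deg\<close> provides.\<close>
  have "\<exists>f. graph_embedding ?T G f \<and> f p = u \<and> f ` uverts ?T \<inter> {w, w'} = {}"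
  proof (rule tree_embedding_avoiding[OF _ _ G _ u])
    show "tree_graph ?T" by (rule tree_graph_delete_leaf[OF T(1) l(1)])
    show "p \<in> uverts ?T" using p by (simp add: delete_vertex_def)
    show "card (uverts ?T) + card {w, w'} \<le> vertex_degree G v" if "v \<in> uverts G" for v
      using deg[OF that] card_uverts_delete_vertex[OF sT lT] pos
      by (cases "w = w'") auto
  qed simp
  then obtain f where f: "graph_embedding ?T G f" "f p = u" "f ` uverts ?T \<inter> {w, w'} = {}"
    by blast
  \<comment> \<open>Moving \<open>l\<close> to either vertex leaves the image of \<open>l'\<close>
    in place, so \<open>c (f l')\<close> serves as the common reference color.\<close>
  have "c x = c (f l')" if x: "x \<in> {w, w'}" for x
  proof -
    have "graph_embedding T G (f(l := x))"
      by (rule graph_embedding_extend_leaf[OF sT p(1,3) f(1) G])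
        (use w x f in \<open>auto simp: delete_vertex_def\<close>)
    from graph_embedding_leaves_same_color[OF sT this c l(1,2)]
    show ?thesis using l(3) by simp
  qed
  then show ?thesis by simp
qed

section \<open>Mantel's bound and the case of large minimum degree\<close>

lemma mult_diff_le_square_div_4:
  fixes d n :: nat
  assumes "d \<le> n"
  shows "d * (n - d) \<le> n\<^sup>2 div 4"
proof -
  obtain m where m: "n = d + m" using assms by (auto simp: le_iff_add)
  \<comment> \<open>Equivalent to the square of \<open>d - m\<close> being nonnegative; integers are
    used because this difference may be negative.\<close>
  have "4 * int (d * m) \<le> (int (d + m))\<^sup>2"
    using zero_le_power2[of "int d - int m"] by (simp add: power2_eq_square algebra_simps)
  then have "4 * (d * m) \<le> (d + m)\<^sup>2"
    by (metis (mono_tags) of_nat_le_iff of_nat_mult of_nat_numeral of_nat_power)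
  then show ?thesis by (simp add: m)
qed

text \<open>Mantel's theorem. The neighbourhood of a vertex \<open>u\<close> of maximum degree
  \<open>?D\<close> is independent, so its complement \<open>?B\<close> meets every edge. Summing
  degrees over \<open>?B\<close> bounds the edges by \<open>(n - ?D) * ?D\<close>, where
  \<open>n\<close> is the number of vertices.\<close>

lemma triangle_free_card_uedges_le:
  assumes G: "simple_graph G"
    and indep: "\<And>u v w. v \<in> neighbors G u \<Longrightarrow> w \<in> neighbors G u \<Longrightarrow> {v, w} \<notin> uedges G"
  shows "card (uedges G) \<le> (card (uverts G))\<^sup>2 div 4"
proof (cases "uverts G = {}")
  case True
  then have "uedges G = {}" using G by (fastforce simp: simple_graph_def)
  then show ?thesis by simp
next
  case False
  have fin: "finite (uverts G)" using G by (simp add: simple_graph_def)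
  let ?D = "Max (vertex_degree G ` uverts G)"
  have "?D \<in> vertex_degree G ` uverts G" by (rule Max_in) (use fin False in auto)
  then obtain u where u: "u \<in> uverts G" "vertex_degree G u = ?D" by (metis imageE)
  let ?B = "uverts G - neighbors G u"
  have "\<exists>v\<in>?B. v \<in> e" if e: "e \<in> uedges G" for e
  proof -
    obtain x y where xy: "e = {x, y}" using G e by (metis card_2_iff simple_graph_def)
    then show ?thesis using indep[of x u y] e simple_graph_edgeD[OF G, of x y] by auto
  qed
  then have "uedges G \<subseteq> (\<Union>v\<in>?B. {e \<in> uedges G. v \<in> e})" by blast
  then have "card (uedges G) \<le> card (\<Union>v\<in>?B. {e \<in> uedges G. v \<in> e})"
    by (rule card_mono[rotated]) (use fin finite_uedges[OF G] in auto)
  also have "\<dots> \<le> (\<Sum>v\<in>?B. vertex_degree G v)"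
    unfolding vertex_degree_def by (rule card_UN_le) (use fin in simp)
  also have "\<dots> \<le> card ?B * ?D"
    using sum_bounded_above[of ?B "vertex_degree G" ?D] fin by simp
  also have "card ?B = card (uverts G) - ?D"
    using card_Diff_subset[OF finite_neighbors[OF G] neighbors_subset[OF G]] u
    by (simp add: vertex_degree_eq_card_neighbors[OF G])
  also have "(card (uverts G) - ?D) * ?D \<le> (card (uverts G))\<^sup>2 div 4"
    using mult_diff_le_square_div_4[of ?D "card (uverts G)"] u(2)
      card_mono[OF fin neighbors_subset[OF G], of u]
    by (simp add: vertex_degree_eq_card_neighbors[OF G] mult.commute)
  finally show ?thesis .
qed

text \<open>An edge between two neighbours of \<open>u\<close> would have ends of equal color,
  against properness; hence Mantel's bound applies.\<close>

lemma card_uedges_le_of_min_degree: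
  assumes T: "tree_graph T" "uedges T \<noteq> {}" and G: "simple_graph G" "leaf_colorable T G"
    and deg: "\<And>v. v \<in> uverts G \<Longrightarrow> card (uverts T) < vertex_degree G v"
  shows "card (uedges G) \<le> (card (uverts G))\<^sup>2 div 4"
proof (rule triangle_free_card_uedges_le[OF G(1)])
  fix u v w assume vw: "v \<in> neighbors G u" "w \<in> neighbors G u"
  obtain c :: "'b \<Rightarrow> nat" where c: "proper_vertex_coloring G c"
    "\<And>H. sub_graph H G \<Longrightarrow> graph_isomorphic T H \<Longrightarrow> leaves_same_color H c"
    using G(2) unfolding leaf_colorable_def by blast
  have "c v = c w" by (rule monochromatic_neighbors[OF T G(1) deg c(2) vw])
  then show "{v, w} \<notin> uedges G" using c(1) by (auto simp: proper_vertex_coloring_def)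
qed

section \<open>Removing vertices of small degree\<close>

lemma square_Suc_div_4: "(Suc m)\<^sup>2 div 4 = m\<^sup>2 div 4 + Suc m div 2"
proof (cases "even m")
  case True
  then obtain a where "m = 2 * a" by (auto elim: evenE)
  then show ?thesis by (simp add: power2_eq_square algebra_simps)
next
  case False
  then obtain a where "m = 2 * a + 1" by (auto elim: oddE)
  then show ?thesis by (simp add: power2_eq_square algebra_simps)
qed

text \<open>Here \<open>2 ^ N\<close> is the crude edge bound on \<open>N\<close> vertices, which
  starts the induction. Each further vertex lowers the allowed surplus by one until the truncated
  subtraction reaches 0. \<open>N\<close> is large enough that, beyond it, a vertex of degree at
  most \<open>card (uverts T)\<close> contributes less than the growth of the quadratic
  term.\<close>

lemma card_uedges_le_surplus:
  fixes T :: "'t ugraph" and G :: "'a ugraph"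
  defines "N \<equiv> 2 * card (uverts T) + 2"
  assumes T: "tree_graph T" "uedges T \<noteq> {}" and "simple_graph G" "leaf_colorable T G"
    and "N \<le> card (uverts G)"
  shows "card (uedges G) \<le> (card (uverts G))\<^sup>2 div 4 + (2 ^ N - (card (uverts G) - N))"
  using assms(4-6)
proof (induction "card (uverts G)" arbitrary: G)
  case 0
  then show ?case by (simp add: N_def)
next
  case (Suc m)
  note G = \<open>simple_graph G\<close>
  have fin: "finite (uverts G)" using G by (simp add: simple_graph_def)
  show ?case
  proof (cases "Suc m = N")
    case True
    have "card (uedges G) \<le> card (Pow (uverts G))"
      by (rule card_mono) (use G in \<open>auto simp: simple_graph_def\<close>)
    then show ?thesis using True Suc.hyps(2) by (simp add: card_Pow fin)
  next
    case False
    then have N: "N \<le> m" using Suc.prems(3) Suc.hyps(2) by simp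
    show ?thesis
    proof (cases "\<forall>v\<in>uverts G. card (uverts T) < vertex_degree G v")
      case True
      then show ?thesis
        using card_uedges_le_of_min_degree[OF T G Suc.prems(2)] by (simp add: trans_le_add1)
    next
      case False
      then obtain v where v: "v \<in> uverts G" "vertex_degree G v \<le> card (uverts T)"
        by (auto simp: not_less)
      let ?G = "delete_vertex G v"
      have m: "card (uverts ?G) = m"
        using card_uverts_delete_vertex[OF G v(1)] Suc.hyps(2) by simp
      have "card (uedges ?G) \<le> (card (uverts ?G))\<^sup>2 div 4 + (2 ^ N - (card (uverts ?G) - N))"
      proof (rule Suc.hyps(1))
        show "leaf_colorable T ?G"
          by (rule leaf_colorable_sub_graph[OF Suc.prems(2) sub_graph_delete_vertex[OF G]])
      qed (use m N simple_graph_delete_vertex[OF G] in auto)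
      then have "card (uedges G) \<le> m\<^sup>2 div 4 + (2 ^ N - (m - N)) + card (uverts T)"
        using card_uedges_delete_vertex[OF G, of v] v(2) m by simp
      moreover have "card (uverts T) + 1 \<le> Suc m div 2" using N by (simp add: N_def)
      moreover have "2 ^ N - (m - N) \<le> 2 ^ N - (Suc m - N) + 1" by simp
      \<comment> \<open>The quadratic term grows by \<open>Suc m div 2\<close>, at least one more
        than the deleted degree; this spare unit pays for the drop of the surplus.\<close>
      ultimately have "card (uedges G) \<le> (Suc m)\<^sup>2 div 4 + (2 ^ N - (Suc m - N))"
        unfolding square_Suc_div_4 by linarith
      then show ?thesis using Suc.hyps(2) by simp
    qed
  qed
qed

subsection \<open>The lower bound\<close>

text \<open>A connected graph has only one proper 2-coloring up to swapping colors. So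
  \<open>d\<close>, pulled back along the isomorphism, induces the same color classes on
  \<open>T\<close> as \<open>c\<close>.\<close>

lemma leaves_same_color_if_bicolored:
  fixes T :: "'t ugraph" and c :: "'t \<Rightarrow> bool" and d :: "'a \<Rightarrow> nat"
  assumes T: "tree_graph T" "proper_vertex_coloring T c" "leaves_same_color T c"
    and d: "proper_vertex_coloring G d" "\<And>v. v \<in> uverts G \<Longrightarrow> d v < 2"
    and H: "sub_graph H G" "graph_isomorphic T H"
  shows "leaves_same_color H d"
proof -
  have sT: "simple_graph T" using T by (simp add: tree_graph_def)
  obtain f where f: "inj_on f (uverts T)" "uverts H = f ` uverts T"
    "uedges H = (\<lambda>e. f ` e) ` uedges T"
    using H(2) by (auto simp: graph_isomorphic_def bij_betw_def)
  have two_colors: "d (f x) \<noteq> d (f y)" "d (f x) < 2" "d (f y) < 2" if "{x, y} \<in> uedges T" for x y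
  proof -
    have "f ` {x, y} \<in> uedges G" using that H(1) f(3) by (auto simp: sub_graph_def)
    then show "d (f x) \<noteq> d (f y)" using d(1) by (simp add: proper_vertex_coloring_def)
    show "d (f x) < 2" "d (f y) < 2"
      using simple_graph_edgeD[OF sT that] d(2) f(2) H(1) by (auto simp: sub_graph_def)
  qed
  \<comment> \<open>Along a walk from \<open>u\<close> both colorings switch at every edge, so they
    return to the color of \<open>u\<close> at the same vertices.\<close>
  have agree: "c u = c v \<longleftrightarrow> d (f u) = d (f v)" if uv: "u \<in> uverts T" "v \<in> uverts T" for u v
  proof -
    have u: "d (f u) < 2" using uv d(2) f(2) H(1) by (auto simp: sub_graph_def)
    have "(u, v) \<in> {(x, y). {x, y} \<in> uedges T}\<^sup>*"
      using uv T(1) by (simp add: tree_graph_def graph_connected_def)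
    then show ?thesis
    proof (induction rule: rtrancl_induct)
      case (step y z)
      then have yz: "{y, z} \<in> uedges T" by simp
      then have "c y \<noteq> c z" using T(2) by (simp add: proper_vertex_coloring_def)
      moreover have "d (f u) = d (f z) \<longleftrightarrow> d (f u) \<noteq> d (f y)"
        using u two_colors[OF yz] by arith
      ultimately show ?case using step.IH by blast
    qed simp
  qed
  have leaves: "graph_leaves H = f ` graph_leaves T" by (rule graph_leaves_image[OF sT f])
  have "d (f u) = d (f v)" if "u \<in> graph_leaves T" "v \<in> graph_leaves T" for u v
  proof -
    have "c u = c v" using that T(3) unfolding leaves_same_color_def by blast
    then show ?thesis using agree that by (simp add: graph_leaves_def)
  qed
  then show ?thesis unfolding leaves_same_color_def leaves by blast
qed

lemma half_mult_diff_half: "(n div 2) * (n - n div 2) = n\<^sup>2 div 4" for n :: nat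
proof (cases "even n")
  case True
  then obtain a where "n = 2 * a" by (auto elim: evenE)
  then show ?thesis by (simp add: power2_eq_square)
next
  case False
  then obtain a where "n = 2 * a + 1" by (auto elim: oddE)
  then show ?thesis by (simp add: power2_eq_square algebra_simps)
qed

lemma balanced_bipartite_in_ex_c_sizes:
  fixes T :: "'t ugraph" and c :: "'t \<Rightarrow> bool"
  assumes T: "tree_graph T" "proper_vertex_coloring T c" "leaves_same_color T c"
  shows "n\<^sup>2 div 4 \<in> ex_c_sizes n T"
proof -
  \<comment> \<open>The extremal graph is complete bipartite with parts as equal as possible,
    colored by its parts.\<close>
  let ?A = "{..<n div 2}" and ?B = "{n div 2..<n}"
  let ?E = "(\<lambda>(a, b). {a, b}) ` (?A \<times> ?B)"
  let ?G = "\<lparr>uverts = {..<n}, uedges = ?E\<rparr> :: nat ugraph"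
  let ?d = "\<lambda>v. if v < n div 2 then 0 else 1 :: nat"
  have "simple_graph ?G" by (auto simp: simple_graph_def card_insert_if)
  moreover have "card (uverts ?G) = n" by simp
  moreover have "leaf_colorable T ?G"
    unfolding leaf_colorable_def
  proof (intro exI conjI allI impI; (elim conjE)?)
    show d: "proper_vertex_coloring ?G ?d"
      by (auto simp: proper_vertex_coloring_def doubleton_eq_iff)
    show "leaves_same_color H ?d" if "sub_graph H ?G" "graph_isomorphic T H" for H
      by (rule leaves_same_color_if_bicolored[OF T d _ that]) simp
  qed
  moreover have "card (uedges ?G) = n\<^sup>2 div 4"
  proof -
    have "inj_on (\<lambda>(a, b). {a, b}) (?A \<times> ?B)"
      by (auto simp: inj_on_def doubleton_eq_iff)
    then have "card ?E = card (?A \<times> ?B)" by (rule card_image)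
    then show ?thesis by (simp add: card_cartesian_product half_mult_diff_half)
  qed
  ultimately show ?thesis unfolding ex_c_sizes_def by (metis (mono_tags, lifting) mem_Collect_eq)
qed

theorem theorem7:
  fixes T :: "'t ugraph" and k :: nat and c :: "'t \<Rightarrow> bool"
  assumes "tree_graph T"
    and "card (uedges T) = k"
    and "k \<ge> 1"
    and "proper_vertex_coloring T c"
    and "leaves_same_color T c"
  shows "\<exists>n\<^sub>0. \<forall>n\<ge>n\<^sub>0. ex_c n T = n ^ 2 div 4"
proof -
  let ?N = "2 * card (uverts T) + 2"
  have e: "uedges T \<noteq> {}" using assms(2,3) by auto
  \<comment> \<open>From \<open>?N + 2 ^ ?N\<close> vertices on, the allowed surplus is
    exhausted.\<close>
  have "ex_c n T = n ^ 2 div 4" if n: "?N + 2 ^ ?N \<le> n" for n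
    unfolding ex_c_def
  proof (rule Max_eqI[OF finite_ex_c_sizes])
    show "n\<^sup>2 div 4 \<in> ex_c_sizes n T"
      by (rule balanced_bipartite_in_ex_c_sizes[OF assms(1,4,5)])
  next
    fix m assume "m \<in> ex_c_sizes n T"
    then obtain G :: "nat ugraph" where G: "m = card (uedges G)" "simple_graph G"
      "card (uverts G) = n" "leaf_colorable T G"
      unfolding ex_c_sizes_def by blast
    have "2 ^ ?N - (n - ?N) = 0" using n by simp
    then show "m \<le> n\<^sup>2 div 4"
      using card_uedges_le_surplus[OF assms(1) e G(2,4)] n G(1,3) by simp
  qed
  then show ?thesis by blast
qed

end
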